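(* Let $G$ be a group equipped with a $G$-invariant $\sigma$-algebra $\Sigma$, let $\mu$ be a probability measure on $(G,\Sigma)$, and let $\nu_\mu$ be the law on $G^{\mathbb N}$ of the $\mu$-random walk started at the identity. Let $f\colon G\to\mathbb{C}$ be a measurable function such that for $\nu_\mu$-almost every trajectory $(w_n)_n\in G^{\mathbb N}$ the values $f(w_n)$ converge as $n\to\infty$. Let $m$ be a fixed positive integer. Then for $\nu_\mu\times\mu^{*m}$-almost every pair $\left((w_n)_n,\gamma\right)\in G^{\mathbb N}\times G$, $$|f(w_n)-f(w_n\gamma)|\to 0\quad\text{as } n\to\infty .$$
   Context: $G$-invariant means that $\Sigma$ is closed under translations by elements of $G$; it is implicit that multiplication $G\times G\to G$ is measurable from $\Sigma\otimes\Sigma$ to $\Sigma$. The $\mu$-random walk is $X_0=e,X_1,X_2,\dots$, where the increments $X_i^{-1}X_{i+1}$ are independent with law $\mu$; the convolution power $\mu^{*m}$ is the law of $X_m$. *)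

theory Defs
  imports "HOL-Probability.Probability" "HOL-Algebra.Coset"
begin

definition translation_invariant :: "('a, 'b) monoid_scheme \<Rightarrow> 'a set set \<Rightarrow> bool" where
  "translation_invariant G \<Sigma> \<longleftrightarrow>
     (\<forall>g\<in>carrier G. \<forall>A\<in>\<Sigma>. g <#\<^bsub>G\<^esub> A \<in> \<Sigma> \<and> A #>\<^bsub>G\<^esub> g \<in> \<Sigma>)"

definition measurable_group :: "('a, 'b) monoid_scheme \<Rightarrow> 'a set set \<Rightarrow> bool" where
  "measurable_group G \<Sigma> \<longleftrightarrow>
     group G \<and> sigma_algebra (carrier G) \<Sigma> \<and> translation_invariant G \<Sigma> \<and>
     (\<lambda>(x, y). x \<otimes>\<^bsub>G\<^esub> y) \<in>
       sigma (carrier G) \<Sigma> \<Otimes>\<^sub>M sigma (carrier G) \<Sigma> \<rightarrow>\<^sub>M sigma (carrier G) \<Sigma>"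

primrec walk :: "('a, 'b) monoid_scheme \<Rightarrow> (nat \<Rightarrow> 'a) \<Rightarrow> nat \<Rightarrow> 'a" where
  "walk G \<xi> 0 = \<one>\<^bsub>G\<^esub>"
| "walk G \<xi> (Suc n) = walk G \<xi> n \<otimes>\<^bsub>G\<^esub> \<xi> n"

text \<open>The law of the random walk is the image of the infinite product of \<open>\<mu>\<close> (the joint law of
  i.i.d. increments) under the map sending increments to the trajectory they determine; see
  \<open>walk_increment\<close> and \<open>measurable_walk\<close> below.\<close>

definition random_walk_law :: "('a, 'b) monoid_scheme \<Rightarrow> 'a measure \<Rightarrow> (nat \<Rightarrow> 'a) measure" where
  "random_walk_law G \<mu> =
     distr (\<Pi>\<^sub>M i\<in>UNIV. \<mu>) (\<Pi>\<^sub>M i\<in>UNIV. \<mu>) (walk G)"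

definition convolution_power :: "('a, 'b) monoid_scheme \<Rightarrow> 'a measure \<Rightarrow> nat \<Rightarrow> 'a measure" where
  "convolution_power G \<mu> m = distr (random_walk_law G \<mu>) \<mu> (\<lambda>w. w m)"

lemma walk_closed:
  assumes "group G" "\<And>i. \<xi> i \<in> carrier G"
  shows "walk G \<xi> n \<in> carrier G"
proof -
  interpret group G by fact
  show ?thesis by (induction n) (use assms(2) in auto)
qed

lemma walk_increment:
  assumes "group G" "\<And>i. \<xi> i \<in> carrier G"
  shows "inv\<^bsub>G\<^esub> (walk G \<xi> n) \<otimes>\<^bsub>G\<^esub> walk G \<xi> (Suc n) = \<xi> n"
proof -
  interpret group G by fact
  have "walk G \<xi> n \<in> carrier G" by (rule walk_closed[OF assms])
  then show ?thesis using assms(2)[of n] by (simp add: m_assoc[symmetric])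
qed

lemma measurable_group_mult:
  assumes "measurable_group G \<Sigma>" "sets \<mu> = \<Sigma>"
  shows "space \<mu> = carrier G"
    and "(\<lambda>(x, y). x \<otimes>\<^bsub>G\<^esub> y) \<in> \<mu> \<Otimes>\<^sub>M \<mu> \<rightarrow>\<^sub>M \<mu>"
proof -
  interpret S: sigma_algebra "carrier G" \<Sigma>
    using assms(1) by (simp add: measurable_group_def)
  have eq: "sets (sigma (carrier G) \<Sigma>) = sets \<mu>"
    using assms(2) by (simp add: S.sets_measure_of_eq)
  show "space \<mu> = carrier G"
    using sets_eq_imp_space_eq[OF eq] S.space_measure_of_eq by simp
  show "(\<lambda>(x, y). x \<otimes>\<^bsub>G\<^esub> y) \<in> \<mu> \<Otimes>\<^sub>M \<mu> \<rightarrow>\<^sub>M \<mu>"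
    using assms(1) measurable_cong_sets[OF sets_pair_measure_cong[OF eq eq] eq]
    by (simp add: measurable_group_def)
qed

lemma measurable_walk:
  assumes "measurable_group G \<Sigma>" "sets \<mu> = \<Sigma>"
  shows "walk G \<in> (\<Pi>\<^sub>M i\<in>UNIV. \<mu>) \<rightarrow>\<^sub>M (\<Pi>\<^sub>M i\<in>UNIV. \<mu>)"
proof -
  note sp = measurable_group_mult(1)[OF assms] and mult = measurable_group_mult(2)[OF assms]
  have one: "\<one>\<^bsub>G\<^esub> \<in> space \<mu>"
    using assms(1) sp by (simp add: measurable_group_def group.is_monoid monoid.one_closed)
  have "(\<lambda>\<xi>. walk G \<xi> n) \<in> (\<Pi>\<^sub>M i\<in>UNIV. \<mu>) \<rightarrow>\<^sub>M \<mu>" for n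
  proof (induction n)
    case 0
    show ?case using one by simp
  next
    case (Suc n)
    have "(\<lambda>\<xi>. (walk G \<xi> n, \<xi> n)) \<in> (\<Pi>\<^sub>M i\<in>UNIV. \<mu>) \<rightarrow>\<^sub>M \<mu> \<Otimes>\<^sub>M \<mu>"
      by (intro measurable_Pair Suc) simp
    from measurable_compose[OF this mult] show ?case by simp
  qed
  then show ?thesis
    by (intro measurable_PiM_single') (auto dest: measurable_space)
qed

lemma prob_space_random_walk_law:
  assumes "measurable_group G \<Sigma>" "sets \<mu> = \<Sigma>" "prob_space \<mu>"
  shows "prob_space (random_walk_law G \<mu>)"
proof -
  interpret product_prob_space "\<lambda>_::nat. \<mu>" UNIV
    using assms(3) by (simp add: product_prob_space_def product_prob_space_axioms_def
        product_sigma_finite_def prob_space_imp_sigma_finite)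
  show ?thesis
    unfolding random_walk_law_def
    using measurable_walk[OF assms(1,2)] by (intro prob_space_distr)
qed

lemma prob_space_convolution_power:
  assumes "measurable_group G \<Sigma>" "sets \<mu> = \<Sigma>" "prob_space \<mu>"
  shows "prob_space (convolution_power G \<mu> m)"
  unfolding convolution_power_def
  by (intro prob_space.prob_space_distr prob_space_random_walk_law[OF assms])
     (simp add: random_walk_law_def)

end

theory Submission
  imports Defs
begin

text \<open>Since \<open>f\<close> converges along the walk, for each \<open>\<epsilon> > 0\<close> almost surely only finitely many of the
  events \<open>|f(w\<^sub>n) - f(w\<^sub>n\<^sub>+\<^sub>m)| \<ge> \<epsilon>\<close> occur. For each single \<open>n\<close>, replacing \<open>w\<^sub>n\<^sub>+\<^sub>m\<close> by
  \<open>w\<^sub>n \<gamma>\<close> with an independent \<open>\<gamma>\<close> of law \<open>\<mu>\<^sup>*\<^sup>m\<close> does not change the joint law with the past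
  \<open>w\<^sub>0, \<dots>, w\<^sub>n\<close>. As in the conditional Borel--Cantelli lemma, restrict the \<open>n\<close>-th event to the past
  event that none of the events with index between \<open>N\<close> and \<open>n - m\<close> has occurred: at most \<open>m\<close> of the
  restricted events occur, so the expected number of occurrences is at most \<open>m\<close>, and this bound
  carries over to the decoupled events.\<close>

text \<open>If \<open>t\<close> is the first index from \<open>N\<close> on with \<open>B t\<close>,
  the choice \<open>j = t\<close> excludes every \<open>n \<ge> t + m\<close>, so all counted
  indices lie in a window of length \<open>m\<close>.\<close>

lemma suminf_of_bool_first_occurrences_le:
  fixes B :: "nat \<Rightarrow> bool"
  shows "(\<Sum>n. of_bool (N \<le> n \<and> (\<forall>j\<ge>N. j + m \<le> n \<longrightarrow> \<not> B j) \<and> B n) :: ennreal) \<le> of_nat m"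
proof (cases "\<exists>n\<ge>N. B n")
  case False
  then have "(\<lambda>n. of_bool (N \<le> n \<and> (\<forall>j\<ge>N. j + m \<le> n \<longrightarrow> \<not> B j) \<and> B n) :: ennreal) = (\<lambda>_. 0)"
    by auto
  then show ?thesis by simp
next
  case True
  define t where "t = (LEAST n. N \<le> n \<and> B n)"
  have t: "N \<le> t" "B t"
    using LeastI_ex[of "\<lambda>n. N \<le> n \<and> B n"] True unfolding t_def by auto
  have t_le: "t \<le> n" if "N \<le> n" "B n" for n
    unfolding t_def by (rule Least_le) (use that in simp)
  let ?g = "\<lambda>n. of_bool (N \<le> n \<and> (\<forall>j\<ge>N. j + m \<le> n \<longrightarrow> \<not> B j) \<and> B n) :: ennreal"
  have "(\<Sum>n. ?g n) = sum ?g {t..<t + m}"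
  proof (rule suminf_finite)
    show "?g n = 0" if "n \<notin> {t..<t + m}" for n
      using that t t_le[of n] by (auto simp: not_less)
  qed simp
  also have "\<dots> \<le> (\<Sum>n\<in>{t..<t + m}. 1)"
    by (rule sum_mono) auto
  finally show ?thesis by simp
qed

lemma eventually_not_if_suminf_of_bool_finite:
  assumes "(\<Sum>n. of_bool (P n) :: ennreal) \<noteq> \<infinity>"
  shows "eventually (\<lambda>n. \<not> P n) sequentially"
proof -
  have "summable (\<lambda>n. of_bool (P n) :: real)"
    using assms by (intro summable_suminf_not_top) (auto simp: of_bool_def if_distrib cong: if_cong)
  then have "(\<lambda>n. of_bool (P n) :: real) \<longlonglongrightarrow> 0"
    by (rule summable_LIMSEQ_zero)
  then have "eventually (\<lambda>n. (of_bool (P n) :: real) < 1) sequentially"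
    by (rule order_tendstoD) simp
  then show ?thesis
    by eventually_elim auto
qed

lemma measurable_shift_PiM:
  "(\<lambda>\<omega> i. \<omega> (n + i)) \<in> (\<Pi>\<^sub>M i\<in>UNIV. M) \<rightarrow>\<^sub>M (\<Pi>\<^sub>M i\<in>(UNIV :: nat set). M)"
  by (rule measurable_PiM_single') (auto simp: space_PiM PiE_iff)

text \<open>\<open>comb_seq n\<close> keeps the first \<open>n\<close> coordinates of one sequence
  and continues with a second one; applied to independent samples of \<open>S\<close> it again has
  law \<open>S\<close>. As \<open>D n\<close> sees only those \<open>n\<close> coordinates of its
  first argument, at each single \<open>n\<close> an independent sequence can replace the shifted
  tail. The bounded look-ahead \<open>m\<close> keeps the expected counts finite.\<close>

lemma (in sequence_space) AE_eventually_not_decoupled: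
  fixes D :: "nat \<Rightarrow> (nat \<Rightarrow> 'a) \<Rightarrow> (nat \<Rightarrow> 'a) \<Rightarrow> bool"
  assumes D_meas: "\<And>n. Measurable.pred (S \<Otimes>\<^sub>M S) (\<lambda>(\<omega>, \<omega>'). D n \<omega> \<omega>')"
    and D_past: "\<And>n \<omega> \<omega>\<^sub>1 \<omega>'. (\<And>i. i < n \<Longrightarrow> \<omega> i = \<omega>\<^sub>1 i) \<Longrightarrow> D n \<omega> \<omega>' = D n \<omega>\<^sub>1 \<omega>'"
    and D_future: "\<And>n \<omega> \<omega>' \<omega>\<^sub>1. (\<And>i. i < m \<Longrightarrow> \<omega>' i = \<omega>\<^sub>1 i) \<Longrightarrow> D n \<omega> \<omega>' = D n \<omega> \<omega>\<^sub>1"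
    and D_AE: "AE \<omega> in S. eventually (\<lambda>n. \<not> D n \<omega> (\<lambda>i. \<omega> (n + i))) sequentially"
  shows "AE (\<omega>, \<omega>') in S \<Otimes>\<^sub>M S. eventually (\<lambda>n. \<not> D n \<omega> \<omega>') sequentially"
proof -
  interpret SS: pair_sigma_finite S S ..
  define B where "B n \<omega> \<longleftrightarrow> D n \<omega> (\<lambda>i. \<omega> (n + i))" for n \<omega>
  \<comment> \<open>\<open>B j\<close> reads only coordinates below \<open>j + m\<close>, so the
    restriction \<open>j + m \<le> n\<close> makes \<open>Q N n\<close> an event of the first
    \<open>n\<close> coordinates.\<close>
  define Q where "Q N n \<omega> \<longleftrightarrow> (\<forall>j\<ge>N. j + m \<le> n \<longrightarrow> \<not> B j \<omega>)" for N n \<omega>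
  have [measurable]: "Measurable.pred S (\<lambda>\<omega>. B n \<omega>)" for n
    using measurable_compose[OF measurable_Pair[OF measurable_ident measurable_shift_PiM[of n]]
        D_meas[of n]]
    unfolding B_def prod.case id_def .
  have [measurable]: "Measurable.pred S (\<lambda>\<omega>. Q N n \<omega>)" for N n
    unfolding Q_def by measurable
  have [measurable]: "Measurable.pred (S \<Otimes>\<^sub>M S) (\<lambda>z. D n (fst z) (snd z))" for n
    using D_meas[of n] by (simp add: case_prod_beta')
  have B_comb: "B j (comb_seq n \<omega> \<omega>') = B j \<omega>" if "j + m \<le> n" for j n \<omega> \<omega>'
  proof -
    have "D j (comb_seq n \<omega> \<omega>') (\<lambda>i. comb_seq n \<omega> \<omega>' (j + i))
        = D j \<omega> (\<lambda>i. comb_seq n \<omega> \<omega>' (j + i))"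
      by (rule D_past) (use that in \<open>simp add: comb_seq_less\<close>)
    also have "\<dots> = D j \<omega> (\<lambda>i. \<omega> (j + i))"
      by (rule D_future) (use that in \<open>simp add: comb_seq_less\<close>)
    finally show ?thesis by (simp add: B_def)
  qed
  have Q_comb: "Q N n (comb_seq n \<omega> \<omega>') = Q N n \<omega>" for N n \<omega> \<omega>'
    by (auto simp: Q_def B_comb)
  \<comment> \<open>Shifting the glued sequence by \<open>n\<close> returns
    \<open>\<omega>'\<close>, so the coupled event becomes the decoupled one.\<close>
  have B_comb_self: "B n (comb_seq n \<omega> \<omega>') = D n \<omega> \<omega>'" for n \<omega> \<omega>'
  proof -
    have "D n (comb_seq n \<omega> \<omega>') \<omega>' = D n \<omega> \<omega>'"
      by (rule D_past) (simp add: comb_seq_less)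
    then show ?thesis
      using comb_seq_add[of n \<omega> \<omega>'] by (simp add: B_def add.commute)
  qed
  have "AE z in S \<Otimes>\<^sub>M S.
      (\<Sum>n. of_bool (N \<le> n \<and> Q N n (fst z) \<and> D n (fst z) (snd z)) :: ennreal) \<noteq> \<infinity>" for N
  proof (rule nn_integral_PInf_AE)
    have "(\<integral>\<^sup>+z. (\<Sum>n. of_bool (N \<le> n \<and> Q N n (fst z) \<and> D n (fst z) (snd z))) \<partial>(S \<Otimes>\<^sub>M S))
        = (\<Sum>n. \<integral>\<^sup>+z. of_bool (N \<le> n \<and> Q N n (fst z) \<and> D n (fst z) (snd z)) \<partial>(S \<Otimes>\<^sub>M S))"
      by (rule nn_integral_suminf) measurable
    \<comment> \<open>The gluing map depends on \<open>n\<close>, so the laws are compared term by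
      term; summation and integral are exchanged before and after.\<close>
    also have "\<dots> = (\<Sum>n. \<integral>\<^sup>+\<omega>. of_bool (N \<le> n \<and> Q N n \<omega> \<and> B n \<omega>) \<partial>S)"
    proof (rule suminf_cong)
      fix n
      have "(\<integral>\<^sup>+\<omega>. of_bool (N \<le> n \<and> Q N n \<omega> \<and> B n \<omega>) \<partial>S)
          = (\<integral>\<^sup>+\<omega>. of_bool (N \<le> n \<and> Q N n \<omega> \<and> B n \<omega>)
              \<partial>distr (S \<Otimes>\<^sub>M S) S (\<lambda>(\<omega>, \<omega>'). comb_seq n \<omega> \<omega>'))"
        by (simp only: PiM_comb_seq)
      also have "\<dots> = (\<integral>\<^sup>+z. of_bool (N \<le> n \<and> Q N n (fst z) \<and> D n (fst z) (snd z)) \<partial>(S \<Otimes>\<^sub>M S))"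
        by (subst nn_integral_distr[OF measurable_comb_seq])
           (measurable, simp add: case_prod_beta' Q_comb B_comb_self)
      finally show "(\<integral>\<^sup>+z. of_bool (N \<le> n \<and> Q N n (fst z) \<and> D n (fst z) (snd z)) \<partial>(S \<Otimes>\<^sub>M S))
          = (\<integral>\<^sup>+\<omega>. of_bool (N \<le> n \<and> Q N n \<omega> \<and> B n \<omega>) \<partial>S)" ..
    qed
    also have "\<dots> = (\<integral>\<^sup>+\<omega>. (\<Sum>n. of_bool (N \<le> n \<and> Q N n \<omega> \<and> B n \<omega>)) \<partial>S)"
      by (rule nn_integral_suminf[symmetric]) measurable
    also have "\<dots> \<le> (\<integral>\<^sup>+\<omega>. of_nat m \<partial>S)"
      unfolding Q_def by (intro nn_integral_mono suminf_of_bool_first_occurrences_le)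
    also have "\<dots> < \<infinity>"
      by (simp add: P.emeasure_space_1 of_nat_less_top)
    finally show "(\<integral>\<^sup>+z. (\<Sum>n. of_bool (N \<le> n \<and> Q N n (fst z) \<and> D n (fst z) (snd z)))
        \<partial>(S \<Otimes>\<^sub>M S)) \<noteq> \<infinity>"
      by simp
  qed measurable
  \<comment> \<open>The threshold \<open>N\<close> chosen below depends on the trajectory, so one
    null set has to serve all \<open>N\<close>.\<close>
  then have "AE z in S \<Otimes>\<^sub>M S. \<forall>N.
      (\<Sum>n. of_bool (N \<le> n \<and> Q N n (fst z) \<and> D n (fst z) (snd z)) :: ennreal) \<noteq> \<infinity>"
    by (simp add: AE_all_countable)
  moreover have "AE z in S \<Otimes>\<^sub>M S. \<exists>N. \<forall>n\<ge>N. \<not> B n (fst z)"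
  proof (rule SS.AE_pair_measure)
    show "AE \<omega> in S. AE \<omega>' in S. \<exists>N. \<forall>n\<ge>N. \<not> B n (fst (\<omega>, \<omega>'))"
      using D_AE by (simp add: B_def eventually_sequentially)
  qed measurable
  ultimately show ?thesis
  proof eventually_elim
    case (elim z)
    then obtain N where N: "\<forall>n\<ge>N. \<not> B n (fst z)" by blast
    \<comment> \<open>Beyond this \<open>N\<close> the past restriction is vacuous, and finiteness
      of the restricted count controls the decoupled events themselves.\<close>
    then have "Q N n (fst z)" for n by (simp add: Q_def)
    with eventually_not_if_suminf_of_bool_finite[OF elim(1)[rule_format, of N]]
    have "eventually (\<lambda>n. \<not> (N \<le> n \<and> D n (fst z) (snd z))) sequentially"
      by simp
    with eventually_ge_at_top[of N] have "eventually (\<lambda>n. \<not> D n (fst z) (snd z)) sequentially"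
      by eventually_elim simp
    then show ?case by (simp add: case_prod_beta')
  qed
qed

lemma walk_cong:
  assumes "\<And>i. i < n \<Longrightarrow> \<xi> i = \<xi>' i"
  shows "walk G \<xi> n = walk G \<xi>' n"
  using assms by (induction n) auto

text \<open>This exhibits the position \<open>n + k\<close> as the position \<open>n\<close> times
  an element built from the later increments alone, which has the form of
  \<open>\<gamma>\<close>.\<close>

lemma walk_add:
  assumes "group G" "\<And>i. \<xi> i \<in> carrier G"
  shows "walk G \<xi> (n + k) = walk G \<xi> n \<otimes>\<^bsub>G\<^esub> walk G (\<lambda>i. \<xi> (n + i)) k"
proof -
  interpret group G by fact
  have "walk G \<xi>' j \<in> carrier G" if "\<And>i. \<xi>' i \<in> carrier G" for \<xi>' j
    using walk_closed[OF assms(1) that] .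
  then show ?thesis
    by (induction k) (simp_all add: assms(2) m_assoc)
qed

theorem proposition3p4:
  fixes G :: "('a, 'b) monoid_scheme"
    and \<Sigma> :: "'a set set"
    and \<mu> :: "'a measure"
    and f :: "'a \<Rightarrow> complex"
    and m :: nat
  assumes "measurable_group G \<Sigma>"
    and "prob_space \<mu>" and "sets \<mu> = \<Sigma>"
    and "f \<in> borel_measurable \<mu>"
    and "AE w in random_walk_law G \<mu>. convergent (\<lambda>n. f (w n))"
    and "m > 0"
  shows "AE (w, \<gamma>) in random_walk_law G \<mu> \<Otimes>\<^sub>M convolution_power G \<mu> m.
           (\<lambda>n. cmod (f (w n) - f (w n \<otimes>\<^bsub>G\<^esub> \<gamma>))) \<longlonglongrightarrow> 0"
proof -
  interpret sequence_space \<mu>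
    using assms(2) by (simp add: sequence_space_def product_prob_space_def
        product_prob_space_axioms_def product_sigma_finite_def prob_space_imp_sigma_finite)
  have G: "group G"
    using assms(1) by (simp add: measurable_group_def)
  note space_\<mu> = measurable_group_mult(1)[OF assms(1,3)]
  note [measurable] = assms(4) measurable_walk[OF assms(1,3)]
  have mult [measurable (raw)]: "(\<lambda>x. g x \<otimes>\<^bsub>G\<^esub> h x) \<in> M \<rightarrow>\<^sub>M \<mu>"
    if "g \<in> M \<rightarrow>\<^sub>M \<mu>" "h \<in> M \<rightarrow>\<^sub>M \<mu>" for g h and M :: "'c measure"
    using measurable_compose[OF measurable_Pair[OF that] measurable_group_mult(2)[OF assms(1,3)]]
    by simp
  have walk_n [measurable]: "(\<lambda>\<xi>. walk G \<xi> n) \<in> S \<rightarrow>\<^sub>M \<mu>" for n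
    by (rule measurable_compose[OF measurable_walk[OF assms(1,3)]]) measurable
  have conv: "convolution_power G \<mu> m = distr S \<mu> (\<lambda>\<xi>. walk G \<xi> m)"
    unfolding convolution_power_def random_walk_law_def
    by (subst distr_distr) (simp_all add: comp_def measurable_walk[OF assms(1,3)])
  \<comment> \<open>Both factors are realised on increment sequences: \<open>\<gamma>\<close> is the
    position at time \<open>m\<close> of a walk with independent increments
    \<open>\<xi>'\<close>.\<close>
  have pair: "random_walk_law G \<mu> \<Otimes>\<^sub>M convolution_power G \<mu> m
      = distr (S \<Otimes>\<^sub>M S) (S \<Otimes>\<^sub>M \<mu>) (\<lambda>(\<xi>, \<xi>'). (walk G \<xi>, walk G \<xi>' m))"
    unfolding conv random_walk_law_def
    by (rule pair_measure_distr)
       (use prob_space_convolution_power[OF assms(1,3,2), of m] in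
         \<open>simp_all add: conv prob_space_imp_sigma_finite measurable_walk[OF assms(1,3)]\<close>)
  \<comment> \<open>For \<open>\<xi>'\<close> the shift of \<open>\<xi>\<close> by \<open>n\<close>,
    the product is \<open>walk G \<xi> (n + m)\<close>, so convergence of \<open>f\<close> along the
    walk rules out \<open>D\<close> for large \<open>n\<close>.\<close>
  define D where "D \<epsilon> n \<xi> \<xi>' \<longleftrightarrow>
      \<epsilon> \<le> cmod (f (walk G \<xi> n) - f (walk G \<xi> n \<otimes>\<^bsub>G\<^esub> walk G \<xi>' m))" for \<epsilon> n \<xi> \<xi>'
  have "AE w in S. convergent (\<lambda>n. f (walk G w n))"
    using AE_distrD[OF measurable_walk[OF assms(1,3)]] assms(5)
    unfolding random_walk_law_def by blast
  then have ev: "AE \<xi> in S. eventually (\<lambda>n. \<not> D \<epsilon> n \<xi> (\<lambda>i. \<xi> (n + i))) sequentially"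
    if "\<epsilon> > 0" for \<epsilon>
    \<comment> \<open>Increments lie in \<open>carrier G\<close> only for points of the space of
      \<open>S\<close>, and \<open>walk_add\<close> needs this.\<close>
    using AE_space
  proof eventually_elim
    case (elim \<xi>)
    then have "\<xi> i \<in> carrier G" for i
      by (auto simp: space_PiM space_\<mu>)
    note add = walk_add[OF G this]
    obtain L where L: "(\<lambda>n. f (walk G \<xi> n)) \<longlonglongrightarrow> L"
      using elim(1) by (auto simp: convergent_def)
    have "(\<lambda>n. cmod (f (walk G \<xi> n) - f (walk G \<xi> (n + m)))) \<longlonglongrightarrow> cmod (L - L)"
      by (intro tendsto_intros L LIMSEQ_ignore_initial_segment)
    then have "eventually (\<lambda>n. cmod (f (walk G \<xi> n) - f (walk G \<xi> (n + m))) < \<epsilon>) sequentially"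
      by (rule order_tendstoD) (use that in simp)
    then show ?case
      by eventually_elim (simp add: D_def add)
  qed
  have "AE (\<xi>, \<xi>') in S \<Otimes>\<^sub>M S. eventually (\<lambda>n. \<not> D \<epsilon> n \<xi> \<xi>') sequentially" if "\<epsilon> > 0" for \<epsilon>
  proof (rule AE_eventually_not_decoupled[where m = m])
    show "Measurable.pred (S \<Otimes>\<^sub>M S) (\<lambda>(\<xi>, \<xi>'). D \<epsilon> n \<xi> \<xi>')" for n
      unfolding D_def by measurable
    show "D \<epsilon> n \<xi> \<xi>' = D \<epsilon> n \<xi>\<^sub>1 \<xi>'" if "\<And>i. i < n \<Longrightarrow> \<xi> i = \<xi>\<^sub>1 i" for n \<xi> \<xi>\<^sub>1 \<xi>'
      using walk_cong[of n \<xi> \<xi>\<^sub>1 G, OF that] by (simp add: D_def)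
    show "D \<epsilon> n \<xi> \<xi>' = D \<epsilon> n \<xi> \<xi>\<^sub>1" if "\<And>i. i < m \<Longrightarrow> \<xi>' i = \<xi>\<^sub>1 i" for n \<xi> \<xi>' \<xi>\<^sub>1
      using walk_cong[of m \<xi>' \<xi>\<^sub>1 G, OF that] by (simp add: D_def)
  qed (rule ev[OF that])
  \<comment> \<open>Countably many thresholds \<open>1/(k+1)\<close> allow a single null set for all
    \<open>\<epsilon>\<close>.\<close>
  then have "AE z in S \<Otimes>\<^sub>M S. \<forall>k.
      eventually (\<lambda>n. \<not> D (inverse (real (Suc k))) n (fst z) (snd z)) sequentially"
    by (simp add: AE_all_countable case_prod_beta')
  then have "AE (\<xi>, \<xi>') in S \<Otimes>\<^sub>M S.
      (\<lambda>n. cmod (f (walk G \<xi> n) - f (walk G \<xi> n \<otimes>\<^bsub>G\<^esub> walk G \<xi>' m))) \<longlonglongrightarrow> 0"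
  proof eventually_elim
    case (elim z)
    have "(\<lambda>n. cmod (f (walk G (fst z) n) - f (walk G (fst z) n \<otimes>\<^bsub>G\<^esub> walk G (snd z) m))) \<longlonglongrightarrow> 0"
    proof (rule order_tendstoI)
      fix \<epsilon> :: real assume "0 < \<epsilon>"
      then obtain k where "inverse (real (Suc k)) < \<epsilon>"
        using reals_Archimedean by blast
      with elim[rule_format, of k] show "eventually (\<lambda>n. cmod (f (walk G (fst z) n)
          - f (walk G (fst z) n \<otimes>\<^bsub>G\<^esub> walk G (snd z) m)) < \<epsilon>) sequentially"
        by (auto simp: D_def elim: eventually_mono)
    qed (simp add: order.strict_trans2[OF _ norm_ge_zero])
    then show ?case by (simp add: case_prod_beta')
  qed
  then show ?thesis
    unfolding pair by (subst AE_distr_iff) (measurable, simp add: case_prod_beta')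
qed

end
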